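(* Every connected graph $G$ admits a strict majority dynamic monopoly of size at most $\alpha'(G)+1$. More generally, if $G$ has $c$ connected components, then $G$ admits a strict majority dynamic monopoly of size at most $\alpha'(G)+c$.
   Context: Graphs are finite, undirected, simple. $\alpha'(G)$ denotes the matching number (maximum number of pairwise disjoint edges). The strict majority threshold is $\tau(v)=\lceil(\deg(v)+1)/2\rceil$. For $M\subseteq V(G)$, the dynamic process starting from $M$ is $D_0=M$ and, for $i\ge0$, $D_{i+1}$ = set of vertices $v\notin D_0\cup\dots\cup D_i$ with at least $\tau(v)$ neighbours in $D_0\cup\dots\cup D_i$; $M$ is a strict majority dynamic monopoly if $\bigcup_i D_i=V(G)$. *)

theory Defs
  imports "Graph_Theory.Graph_Theory"
begin

text \<open>A finite simple undirected graph is a \<^locale>\<open>pair_graph\<close>: an edge \<open>uv\<close> is represented by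
  the two arcs \<open>(u, v)\<close> and \<open>(v, u)\<close>.\<close>

definition edges :: "'a pair_pre_digraph \<Rightarrow> 'a set set" where
  "edges G = {{u, v} | u v. (u, v) \<in> parcs G}"

definition matching :: "'a pair_pre_digraph \<Rightarrow> 'a set set \<Rightarrow> bool" where
  "matching G F \<longleftrightarrow> F \<subseteq> edges G \<and> pairwise disjnt F"

definition matching_number :: "'a pair_pre_digraph \<Rightarrow> nat" where
  "matching_number G = Max (card ` {F. matching G F})"

text \<open>The graphs in this set are \<^typ>\<open>('a, 'a \<times> 'a) pre_digraph\<close>s, because maximal subgraphs
  are defined for general digraphs.\<close>

definition components :: "'a pair_pre_digraph \<Rightarrow> ('a, 'a \<times> 'a) pre_digraph set" where
  "components G = {H. pre_digraph.max_subgraph (with_proj G) connected H}"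

definition neighbours :: "'a pair_pre_digraph \<Rightarrow> 'a \<Rightarrow> 'a set" where
  "neighbours G v = {w. (v, w) \<in> parcs G}"

definition degree :: "'a pair_pre_digraph \<Rightarrow> 'a \<Rightarrow> nat" where
  "degree G v = card (neighbours G v)"

definition strict_majority :: "'a pair_pre_digraph \<Rightarrow> 'a \<Rightarrow> nat" where
  "strict_majority G v = nat \<lceil>(real (degree G v) + 1) / 2\<rceil>"

fun dynamic_process :: "'a pair_pre_digraph \<Rightarrow> 'a set \<Rightarrow> nat \<Rightarrow> 'a set" where
  "dynamic_process G M 0 = M"
| "dynamic_process G M (Suc i) =
    {v \<in> pverts G. v \<notin> (\<Union>j\<in>{..i}. dynamic_process G M j) \<and>
      strict_majority G v \<le> card (neighbours G v \<inter> (\<Union>j\<in>{..i}. dynamic_process G M j))}"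

definition strict_majority_dynamo :: "'a pair_pre_digraph \<Rightarrow> 'a set \<Rightarrow> bool" where
  "strict_majority_dynamo G M \<longleftrightarrow>
    M \<subseteq> pverts G \<and> (\<Union>i. dynamic_process G M i) = pverts G"

lemma strongly_connected_imp_connected:
  assumes "wf_digraph H" "strongly_connected H"
  shows "connected H"
proof -
  interpret wf_digraph H by fact
  show ?thesis using assms(2)
    by (auto simp: strongly_connected_def intro!: connectedI reachable_mk_symmetricI)
qed

lemma components_eq_sccs:
  assumes "pair_graph G"
  shows "components G = pre_digraph.sccs (with_proj G)"
proof -
  interpret pair_graph G by fact
  have sc: "strongly_connected (with_proj G \<restriction> verts H)"
    if "subgraph H (with_proj G)" "connected H" for H
  proof -
    let ?I = "with_proj G \<restriction> verts H"
    have "verts H \<subseteq> pverts G" using that(1) by (auto simp: subgraph_def)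
    then have ind: "induced_subgraph ?I (with_proj G)" by (rule induced_induce)
    then have sub: "subgraph ?I (with_proj G)" by (rule induced_imp_subgraph)
    have "spanning H ?I" unfolding spanning_def using that subgraph_induce_subgraphI2 by auto
    moreover have wf: "wf_digraph ?I" using sub by auto
    ultimately have "connected ?I" using wf_digraph.connected_spanning_imp_connected that by blast
    moreover have "symmetric ?I" using ind sym_arcs induced_graph_imp_symmetric by blast
    ultimately show ?thesis using wf wf_digraph.symmetric_connected_imp_strongly_connected by blast
  qed
  show ?thesis
  proof (intro set_eqI iffI)
    fix H assume "H \<in> components G"
    then have m: "max_subgraph connected H" by (simp add: components_def)
    then have s: "subgraph H (with_proj G)" "connected H" by (auto simp: max_subgraph_def)
    have w: "wf_digraph (with_proj G \<restriction> verts H)" by (simp add: wellformed_induce_subgraph)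
    have "subgraph (with_proj G \<restriction> verts H) (with_proj G)"
      using s(1) by (auto intro!: subgraph_induce_subgraphI simp: subgraph_def[of H])
    then have "H = with_proj G \<restriction> verts H"
      using m strongly_connected_imp_connected[OF w sc[OF s]] subgraph_induce_subgraphI2[OF s(1)] unfolding max_subgraph_def
      by metis
    with sc[OF s] have "strongly_connected H" by simp
    then show "H \<in> sccs" unfolding sccs_altdef2 using m s
      by (auto simp: max_subgraph_def intro: strongly_connected_imp_connected)
  next
    fix H assume "H \<in> sccs"
    then have m: "max_subgraph strongly_connected H" by (simp add: sccs_altdef2)
    then have s: "subgraph H (with_proj G)" "strongly_connected H" by (auto simp: max_subgraph_def)
    then have c: "connected H" by (auto intro: strongly_connected_imp_connected)
    have "H' = H" if h: "subgraph H H'" "subgraph H' (with_proj G)" "connected H'" for H'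
    proof -
      let ?I = "with_proj G \<restriction> verts H'"
      have "subgraph H' ?I" using h(2) by (rule subgraph_induce_subgraphI2)
      moreover have "subgraph ?I (with_proj G)"
        using h(2) by (auto intro!: subgraph_induce_subgraphI simp: subgraph_def[of H'])
      moreover have "subgraph H ?I" using h(1) \<open>subgraph H' ?I\<close> by (rule subgraph_trans)
      ultimately have "?I = H" using m sc[OF h(2,3)] unfolding max_subgraph_def by metis
      with \<open>subgraph H' ?I\<close> h(1) show ?thesis
        by (auto simp: subgraph_def compatible_def intro!: pre_digraph.equality)
    qed
    then show "H \<in> components G" using s c by (auto simp: components_def max_subgraph_def)
  qed
qed

lemma out_degree_eq_degree: "out_degree (with_proj G) v = degree G v"
proof -
  have "out_arcs (with_proj G) v = Pair v ` neighbours G v" by (auto simp: out_arcs_def neighbours_def)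
  then show ?thesis by (simp add: out_degree_def degree_def card_image inj_on_def)
qed

end

theory Submission
  imports Defs
begin

text \<open>Seeding every vertex that belongs to all maximum matchings of the inactive part, one after
  another, costs one seed per drop of the matching number. Once no such vertex is left, Gallai's
  lemma shows that every component \<open>K\<close> of the inactive part has \<open>\<alpha>'(K) = (|K| - 1) / 2\<close>. A linear
  ordering of \<open>K\<close> yields a seed set, namely the vertices for which the neighbours active by then
  are not a strict majority. A suitable ordering and its reverse yield two seed sets with no common
  element, except possibly one if \<open>K\<close> has no active neighbour at all, in which case \<open>K\<close> is a
  component of the whole graph. The smaller of the two has size at most \<open>\<alpha>'(K)\<close>, or
  \<open>\<alpha>'(K) + 1\<close> in the exceptional case.\<close>

section \<open>Activation from a seed set, and cuts of vertex sets\<close>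

lemma strict_majority_le_iff: "strict_majority G v \<le> k \<longleftrightarrow> degree G v < 2 * k"
proof -
  have "strict_majority G v \<le> k \<longleftrightarrow> (real (degree G v) + 1) / 2 \<le> real k"
    unfolding strict_majority_def by (simp add: nat_le_iff ceiling_le_iff)
  then show ?thesis by (simp add: field_simps) linarith
qed

text \<open>The union of all stages, without the stage numbers. Letting \<open>B\<close> be an
  arbitrary set of activated vertices keeps the rule evidently monotone, and the threshold has the
  ceiling-free form of \<open>strict_majority_le_iff\<close>.\<close>

inductive_set activated :: "'a pair_pre_digraph \<Rightarrow> 'a set \<Rightarrow> 'a set" for G A where
  seed: "v \<in> A \<Longrightarrow> v \<in> activated G A"
| majority: "v \<in> pverts G \<Longrightarrow> \<forall>w\<in>B. w \<in> activated G A \<Longrightarrow>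
    degree G v < 2 * card (neighbours G v \<inter> B) \<Longrightarrow> v \<in> activated G A"

lemma activated_least:
  assumes "A \<subseteq> activated G B" shows "activated G A \<subseteq> activated G B"
proof
  fix v assume "v \<in> activated G A"
  then show "v \<in> activated G B"
    by induction (use assms in \<open>auto intro: activated.majority\<close>)
qed

lemma activated_mono: "A \<subseteq> B \<Longrightarrow> activated G A \<subseteq> activated G B"
  by (rule activated_least) (auto intro: activated.seed)

text \<open>Closedness under adjacency is relative to \<open>S\<close>, so that connectedness can be handled by cuts
  instead of walks.\<close>

definition closed_in :: "'a pair_pre_digraph \<Rightarrow> 'a set \<Rightarrow> 'a set \<Rightarrow> bool" where
  "closed_in G S T \<longleftrightarrow> T \<subseteq> S \<and> (\<forall>v\<in>T. neighbours G v \<inter> S \<subseteq> T)"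

text \<open>Every component of \<open>S\<close> contains a vertex of \<open>R\<close> or has a neighbour in the active set \<open>X\<close>.
  In the end \<open>R\<close> has one vertex per component of \<open>G\<close>, and \<open>card R\<close> bounds the number of exceptional
  components.\<close>

definition anchored :: "'a pair_pre_digraph \<Rightarrow> 'a set \<Rightarrow> 'a set \<Rightarrow> 'a set \<Rightarrow> bool" where
  "anchored G S X R \<longleftrightarrow> (\<forall>T. closed_in G S T \<longrightarrow> T \<noteq> {} \<longrightarrow>
    T \<inter> R \<noteq> {} \<or> (\<exists>v\<in>T. neighbours G v \<inter> X \<noteq> {}))"

section \<open>Connected growth and pairs of seed sets\<close>

text \<open>Connectedness as a construction order: every vertex but the root has an earlier
  neighbour. Undoing the construction peels off vertices that still have a remaining neighbour,
  until only \<open>r\<close> is left.\<close>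

inductive grown :: "'a pair_pre_digraph \<Rightarrow> 'a \<Rightarrow> 'a set \<Rightarrow> bool" for G r where
  root: "grown G r {r}"
| grow: "grown G r S \<Longrightarrow> v \<notin> S \<Longrightarrow> neighbours G v \<inter> S \<noteq> {} \<Longrightarrow> grown G r (insert v S)"

lemma grown_finite: "grown G r S \<Longrightarrow> finite S"
  by (induction rule: grown.induct) auto

lemma grown_root_mem: "grown G r S \<Longrightarrow> r \<in> S"
  by (induction rule: grown.induct) auto

text \<open>\<open>P\<close> and \<open>Q\<close> are the vertices placed before and after all of
  \<open>S\<close>. \<open>M1\<close> serves the ordering, where \<open>P\<close> is active first,
  and \<open>M2\<close> its reverse, where \<open>Q\<close> is; \<open>X\<close> is active in
  both.\<close>

definition two_seeds ::
  "'a pair_pre_digraph \<Rightarrow> 'a set \<Rightarrow> 'a set \<Rightarrow> 'a set \<Rightarrow> 'a set \<Rightarrow> nat \<Rightarrow> bool" where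
  "two_seeds G S P Q X k \<longleftrightarrow> (\<exists>M1 M2. M1 \<subseteq> S \<and> M2 \<subseteq> S \<and>
    S \<subseteq> activated G (M1 \<union> P \<union> X) \<and> S \<subseteq> activated G (M2 \<union> Q \<union> X) \<and> card M1 + card M2 \<le> k)"

lemma two_seeds_swap: "two_seeds G S P Q X k \<Longrightarrow> two_seeds G S Q P X k"
  unfolding two_seeds_def by (metis add.commute)

lemma two_seeds_mono: "two_seeds G S P Q X k \<Longrightarrow> k \<le> l \<Longrightarrow> two_seeds G S P Q X l"
  unfolding two_seeds_def by (meson order_trans)

section \<open>Matchings inside a vertex set\<close>

text \<open>Restricting the edges to \<open>S\<close> instead of passing to an induced subgraph
  leaves \<open>G\<close>, and with it all degrees and thresholds, unchanged.\<close>

definition matching_within :: "'a pair_pre_digraph \<Rightarrow> 'a set \<Rightarrow> 'a set set \<Rightarrow> bool" where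
  "matching_within G S F \<longleftrightarrow> matching G F \<and> \<Union>F \<subseteq> S"

definition matching_number_within :: "'a pair_pre_digraph \<Rightarrow> 'a set \<Rightarrow> nat" where
  "matching_number_within G S = Max (card ` {F. matching_within G S F})"

definition max_matching_within :: "'a pair_pre_digraph \<Rightarrow> 'a set \<Rightarrow> 'a set set \<Rightarrow> bool" where
  "max_matching_within G S F \<longleftrightarrow>
    matching_within G S F \<and> card F = matching_number_within G S"

lemma matching_within_subset: "matching_within G S F \<Longrightarrow> F' \<subseteq> F \<Longrightarrow> matching_within G S F'"
  by (auto simp: matching_within_def matching_def intro: pairwise_subset)

lemma matching_within_insert:
  assumes "matching_within G S F" "e \<in> edges G" "e \<subseteq> S" "e \<inter> \<Union>F = {}"
  shows "matching_within G S (insert e F)"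
  using assms unfolding matching_within_def matching_def
  by (auto simp: pairwise_insert disjnt_def)

context pair_graph
begin

section \<open>Neighbourhoods and the dynamic process\<close>

lemma neighbours_sym: "w \<in> neighbours G v \<Longrightarrow> v \<in> neighbours G w"
  using arcs_symmetric by (auto simp: neighbours_def)

lemma neighbours_irrefl: "v \<notin> neighbours G v"
  using pair_no_loops by (fastforce simp: neighbours_def)

lemma neighbours_subset: "neighbours G v \<subseteq> pverts G"
  by (auto simp: neighbours_def dest: arc_snd_in_verts)

lemma edges_subset: "edges G \<subseteq> Pow (pverts G)"
  by (auto simp: edges_def dest: arc_fst_in_verts arc_snd_in_verts)

lemma finite_neighbours: "finite (neighbours G v)"
  using neighbours_subset by (rule finite_subset) simp

lemma activated_majority:
  assumes "v \<in> pverts G" "B \<subseteq> activated G A" "degree G v < 2 * card (neighbours G v \<inter> B)"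
  shows "v \<in> activated G A"
  using assms by (auto intro: activated.majority)

lemma dynamo_if_activated:
  assumes "M \<subseteq> pverts G" "pverts G \<subseteq> activated G M"
  shows "strict_majority_dynamo G M"
proof -
  let ?W = "\<Union>i. dynamic_process G M i"
  have "dynamic_process G M i \<subseteq> pverts G" for i
    using assms(1) by (cases i) auto
  then have W: "?W \<subseteq> pverts G" by auto
  have "activated G M \<subseteq> ?W"
  proof
    fix v assume "v \<in> activated G M"
    then show "v \<in> ?W"
    proof induction
      case (seed v)
      then have "v \<in> dynamic_process G M 0" by simp
      then show ?case by blast
    next
      case (majority v B)
      let ?N = "neighbours G v \<inter> B"
      have fin: "finite ?N" using finite_neighbours by auto
      have "\<forall>w\<in>?N. \<exists>i. w \<in> dynamic_process G M i" using majority by auto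
      then obtain f where f: "\<And>w. w \<in> ?N \<Longrightarrow> w \<in> dynamic_process G M (f w)" by metis
      \<comment> \<open>A stage by which all counted neighbours are active; it exists because
        neighbourhoods are finite. The inserted \<open>0\<close> keeps the argument of
        \<open>Max\<close> nonempty.\<close>
      define i where "i = Max (insert 0 (f ` ?N))"
      have "f w \<le> i" if "w \<in> ?N" for w
        using fin that by (auto simp: i_def intro: Max_ge)
      then have sub: "?N \<subseteq> neighbours G v \<inter> (\<Union>j\<in>{..i}. dynamic_process G M j)"
        using f by auto
      have "card ?N \<le> card (neighbours G v \<inter> (\<Union>j\<in>{..i}. dynamic_process G M j))"
        by (rule card_mono[OF _ sub]) (use finite_neighbours in auto)
      moreover have "strict_majority G v \<le> card ?N"
        using majority by (simp add: strict_majority_le_iff)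
      ultimately have "v \<in> (\<Union>j\<in>{..i}. dynamic_process G M j) \<or>
          v \<in> dynamic_process G M (Suc i)"
        using majority(1) by auto
      then show ?case by blast
    qed
  qed
  then show ?thesis using assms W by (auto simp: strict_majority_dynamo_def)
qed

section \<open>Seed sets from an ordering and its reverse\<close>

text \<open>Here \<open>v\<close> is placed just before \<open>S\<close>: it sees \<open>P\<close>
  and \<open>X\<close> in the ordering, and \<open>S\<close>, \<open>Q\<close> and \<open>X\<close>
  in the reverse. It costs one seed unless it lacks a majority both times, which forces the tie in
  the last summand.\<close>

lemma two_seeds_peel:
  assumes two: "two_seeds G S (insert v P) Q X k"
    and v: "v \<in> pverts G" "v \<notin> S" and fin: "finite S"
    and nb: "neighbours G v \<subseteq> S \<union> P \<union> Q \<union> X"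
    and dis: "S \<inter> P = {}" "S \<inter> Q = {}" "S \<inter> X = {}" "P \<inter> Q = {}" "P \<inter> X = {}" "Q \<inter> X = {}"
  shows "two_seeds G (insert v S) P Q X (Suc k +
    (if neighbours G v \<inter> X = {} \<and>
        card (neighbours G v \<inter> P) = card (neighbours G v \<inter> Q) + card (neighbours G v \<inter> S)
     then 1 else 0))"
proof -
  let ?N = "neighbours G v"
  let ?n = "\<lambda>A. card (?N \<inter> A)"
  obtain M1 M2 where M: "M1 \<subseteq> S" "M2 \<subseteq> S" "S \<subseteq> activated G (M1 \<union> insert v P \<union> X)"
    "S \<subseteq> activated G (M2 \<union> Q \<union> X)" "card M1 + card M2 \<le> k"
    using two unfolding two_seeds_def by blast
  have nUn: "?n (A \<union> B) = ?n A + ?n B" if "A \<inter> B = {}" for A B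
    using that finite_neighbours[of v]
    by (subst Int_Un_distrib, subst card_Un_disjoint) auto
  have "degree G v = ?n (((S \<union> P) \<union> Q) \<union> X)"
    using nb by (simp add: degree_def Int_absorb2)
  also have "\<dots> = ?n S + ?n P + ?n Q + ?n X"
    using dis nUn[of "S \<union> P \<union> Q" X] nUn[of "S \<union> P" Q] nUn[of S P]
    by (simp add: Int_Un_distrib2)
  finally have deg: "degree G v = ?n S + ?n P + ?n Q + ?n X" .
  let ?b1 = "degree G v < 2 * ?n (P \<union> X)"
  let ?b2 = "degree G v < 2 * ?n (S \<union> Q \<union> X)"
  have n1: "?n (P \<union> X) = ?n P + ?n X" using dis by (intro nUn)
  have n2: "?n (S \<union> Q \<union> X) = ?n S + ?n Q + ?n X"
    using dis nUn[of "S \<union> Q" X] nUn[of S Q] by (simp add: Int_Un_distrib2)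
  define L1 where "L1 = (if ?b1 then M1 else insert v M1)"
  define L2 where "L2 = (if ?b2 then M2 else insert v M2)"
  have fM: "finite M1" "finite M2" "v \<notin> M1" "v \<notin> M2" using M v fin finite_subset by auto
  have v1: "v \<in> activated G (L1 \<union> P \<union> X)"
  proof (cases ?b1)
    case True
    show ?thesis by (rule activated_majority[OF v(1) _ True]) (auto intro: activated.seed)
  qed (auto simp: L1_def intro: activated.seed)
  have "activated G (M1 \<union> insert v P \<union> X) \<subseteq> activated G (L1 \<union> P \<union> X)"
    by (rule activated_least) (use v1 in \<open>auto simp: L1_def intro: activated.seed\<close>)
  then have S1: "insert v S \<subseteq> activated G (L1 \<union> P \<union> X)" using M(3) v1 by blast
  have "activated G (M2 \<union> Q \<union> X) \<subseteq> activated G (L2 \<union> Q \<union> X)"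
    by (rule activated_mono) (auto simp: L2_def)
  then have S2: "S \<subseteq> activated G (L2 \<union> Q \<union> X)" using M(4) by blast
  have v2: "v \<in> activated G (L2 \<union> Q \<union> X)"
  proof (cases ?b2)
    case True
    show ?thesis
      by (rule activated_majority[OF v(1) _ True]) (use S2 in \<open>auto intro: activated.seed\<close>)
  qed (auto simp: L2_def intro: activated.seed)
  \<comment> \<open>The failures give \<open>?n P + ?n X \<le> ?n S + ?n Q\<close> and
    \<open>?n S + ?n Q + ?n X \<le> ?n P\<close>; together they force \<open>?n X = 0\<close> and
    equality.\<close>
  have both: "?N \<inter> X = {} \<and> ?n P = ?n Q + ?n S" if "\<not> ?b1" "\<not> ?b2"
  proof -
    have "?n X = 0 \<and> ?n P = ?n Q + ?n S" using that unfolding deg n1 n2 by arith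
    then show ?thesis using finite_neighbours by auto
  qed
  have "card L1 + card L2 \<le> Suc k + (if ?N \<inter> X = {} \<and> ?n P = ?n Q + ?n S then 1 else 0)"
    using M(5) fM both by (auto simp: L1_def L2_def)
  moreover have "L1 \<subseteq> insert v S" "L2 \<subseteq> insert v S" using M(1,2) by (auto simp: L1_def L2_def)
  moreover have "insert v S \<subseteq> activated G (L2 \<union> Q \<union> X)" using S2 v2 by blast
  ultimately show ?thesis unfolding two_seeds_def using S1 by blast
qed

text \<open>Every vertex \<open>v\<close> peeled off \<open>S\<close> is put either before or after all remaining ones; \<open>P\<close> and \<open>Q\<close>
  collect the two kinds. With at least one remaining neighbour, one of the two choices makes the
  numbers of earlier and later neighbours of \<open>v\<close> differ, so that \<open>v\<close> is a seed in at most one of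
  the ordering and its reverse.\<close>

lemma two_seeds_grown:
  assumes "grown G r S" "S \<subseteq> pverts G"
    "\<And>v. v \<in> S \<Longrightarrow> neighbours G v \<subseteq> S \<union> P \<union> Q \<union> X"
    "S \<inter> P = {}" "S \<inter> Q = {}" "S \<inter> X = {}" "P \<inter> Q = {}" "P \<inter> X = {}" "Q \<inter> X = {}"
  shows "two_seeds G S P Q X (card S + (if neighbours G r \<inter> X = {} then 1 else 0))"
  using assms
proof (induction arbitrary: P Q rule: grown.induct)
  case root
  have "neighbours G r \<subseteq> {} \<union> P \<union> Q \<union> X" using root neighbours_irrefl[of r] by auto
  moreover have "two_seeds G {} (insert r P) Q X 0" by (simp add: two_seeds_def)
  ultimately have "two_seeds G {r} P Q X (Suc 0 +
    (if neighbours G r \<inter> X = {} \<and>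
        card (neighbours G r \<inter> P) = card (neighbours G r \<inter> Q) + card (neighbours G r \<inter> {})
     then 1 else 0))"
    using root by (intro two_seeds_peel) auto
  then show ?case by (rule two_seeds_mono) auto
next
  case (grow S v)
  let ?n = "\<lambda>A. card (neighbours G v \<inter> A)"
  let ?k = "card S + (if neighbours G r \<inter> X = {} then 1 else 0)"
  have fin: "finite S" using grow(1) by (rule grown_finite)
  have nb: "neighbours G v \<subseteq> S \<union> P \<union> Q \<union> X" using grow.prems neighbours_irrefl[of v] by auto
  have pos: "?n S > 0" using grow.hyps finite_neighbours[of v] by (simp add: card_gt_0_iff)
  have k: "card (insert v S) + (if neighbours G r \<inter> X = {} then 1 else 0) = Suc ?k"
    using fin grow.hyps by simp
  show ?case unfolding k
  proof (cases "?n P = ?n Q + ?n S")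
    case False
    have "two_seeds G S (insert v P) Q X ?k"
      using grow.prems grow.hyps by (intro grow.IH) auto
    from two_seeds_peel[OF this] show "two_seeds G (insert v S) P Q X (Suc ?k)"
      using grow.prems grow.hyps fin nb False by simp
  next
    case True
    \<comment> \<open>Now \<open>v\<close> goes after \<open>S\<close>, which is the peeling lemma
      with \<open>P\<close> and \<open>Q\<close> exchanged. A second tie would contradict
      \<open>True\<close>, since \<open>?n S\<close> is positive.\<close>
    have "two_seeds G S P (insert v Q) X ?k"
      using grow.prems grow.hyps by (intro grow.IH) auto
    then have "two_seeds G S (insert v Q) P X ?k" by (rule two_seeds_swap)
    from two_seeds_peel[OF this] have "two_seeds G (insert v S) Q P X (Suc ?k)"
      using grow.prems grow.hyps fin nb True pos by (simp add: Un_ac Int_commute)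
    then show "two_seeds G (insert v S) P Q X (Suc ?k)" by (rule two_seeds_swap)
  qed
qed

text \<open>A maximal grown subset of \<open>S\<close> is closed under adjacency, since any
  neighbour left out could be added.\<close>

lemma grown_if_indecomposable:
  assumes "finite S" "r \<in> S" and ind: "\<And>T. closed_in G S T \<Longrightarrow> T \<noteq> {} \<Longrightarrow> T = S"
  shows "grown G r S"
proof -
  let ?C = "{T. grown G r T \<and> T \<subseteq> S}"
  have "finite ?C" using assms(1) by simp
  moreover have "{r} \<in> ?C" using assms(2) by (auto intro: grown.root)
  ultimately obtain T where "T \<in> ?C" and max: "\<forall>U\<in>?C. T \<subseteq> U \<longrightarrow> T = U"
    using finite_has_maximal[of ?C] by (elim meta_impE) auto
  then have T: "grown G r T" "T \<subseteq> S" by auto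
  have "closed_in G S T" unfolding closed_in_def
  proof (intro conjI ballI subsetI)
    fix v w assume vw: "v \<in> T" "w \<in> neighbours G v \<inter> S"
    show "w \<in> T"
    proof (rule ccontr)
      assume "w \<notin> T"
      then have "grown G r (insert w T)"
        using T(1) vw neighbours_sym[of w v] by (intro grown.grow) auto
      then have "insert w T \<in> ?C" using T(2) vw by simp
      then have "T = insert w T" using max by blast
      then show False using \<open>w \<notin> T\<close> by blast
    qed
  qed (use T in auto)
  moreover have "T \<noteq> {}" using grown_root_mem[OF T(1)] by blast
  ultimately show ?thesis using ind T(1) by blast
qed

section \<open>Maximum matchings inside a vertex set\<close>

lemma finite_matchings_within: "finite {F. matching_within G S F}"
proof (rule finite_subset)
  show "{F. matching_within G S F} \<subseteq> Pow (Pow (pverts G))"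
    using edges_subset by (auto simp: matching_within_def matching_def)
qed simp

lemma matching_within_empty: "matching_within G S {}"
  by (simp add: matching_within_def matching_def)

lemma card_matching_within_le: "matching_within G S F \<Longrightarrow> card F \<le> matching_number_within G S"
  unfolding matching_number_within_def using finite_matchings_within by (intro Max_ge) auto

lemma ex_max_matching_within: "\<exists>F. max_matching_within G S F"
proof -
  have "Max (card ` {F. matching_within G S F}) \<in> card ` {F. matching_within G S F}"
    by (rule Max_in) (use finite_matchings_within matching_within_empty in auto)
  then show ?thesis by (auto simp: max_matching_within_def matching_number_within_def)
qed

lemma matching_within_finite: "matching_within G S F \<Longrightarrow> finite F"
  by (rule finite_subset[of _ "Pow (pverts G)"])
     (use edges_subset in \<open>auto simp: matching_within_def matching_def\<close>)

lemma card_edge: "e \<in> edges G \<Longrightarrow> card e = 2"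
  using pair_no_loops by (fastforce simp: edges_def card_2_iff)

lemma card_Union_matching_within:
  assumes "matching_within G S F" shows "finite (\<Union>F)" "card (\<Union>F) = 2 * card F"
proof -
  have F: "F \<subseteq> edges G" "pairwise disjnt F"
    using assms by (auto simp: matching_within_def matching_def)
  then have c: "\<And>e. e \<in> F \<Longrightarrow> card e = 2" using card_edge by blast
  then have f: "\<And>e. e \<in> F \<Longrightarrow> finite e" by (metis card.infinite zero_neq_numeral)
  then show "finite (\<Union>F)" using matching_within_finite[OF assms] by auto
  have "card (\<Union>F) = sum card F" using F(2) f by (rule card_Union_disjoint)
  then show "card (\<Union>F) = 2 * card F" using c by simp
qed

lemma matching_number_within_split:
  assumes "T \<subseteq> S"
  shows "matching_number_within G T + matching_number_within G (S - T) \<le> matching_number_within G S"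
proof -
  obtain F1 F2 where F: "max_matching_within G T F1" "max_matching_within G (S - T) F2"
    using ex_max_matching_within by blast
  then have m: "matching_within G T F1" "matching_within G (S - T) F2"
    by (auto simp: max_matching_within_def)
  have U: "\<Union>F1 \<subseteq> T" "\<Union>F2 \<subseteq> S - T" using m by (auto simp: matching_within_def)
  have F12: "F1 \<subseteq> edges G" "F2 \<subseteq> edges G" "pairwise disjnt F1" "pairwise disjnt F2"
    using m by (auto simp: matching_within_def matching_def)
  have cross: "a \<inter> b = {}" if "a \<in> F1" "b \<in> F2" for a b
    using U that by blast
  have dis: "F1 \<inter> F2 = {}"
  proof (rule ccontr)
    assume "F1 \<inter> F2 \<noteq> {}"
    then obtain e where "e \<in> F1" "e \<in> F2" by blast
    then show False using cross[of e e] F12(1) by (auto simp: edges_def)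
  qed
  have "pairwise disjnt (F1 \<union> F2)"
    using F12(3,4) cross unfolding pairwise_def disjnt_def by (metis Int_commute Un_iff)
  moreover have "\<Union>(F1 \<union> F2) \<subseteq> S" using U assms by blast
  ultimately have "matching_within G S (F1 \<union> F2)"
    using F12(1,2) by (simp add: matching_within_def matching_def)
  then have "card (F1 \<union> F2) \<le> matching_number_within G S" by (rule card_matching_within_le)
  then show ?thesis
    using F dis m matching_within_finite by (simp add: card_Un_disjoint max_matching_within_def)
qed

section \<open>Gallai's lemma\<close>

lemma adjacent_not_both_missed:
  assumes "max_matching_within G S F" "u \<in> S" "v \<in> S" "v \<in> neighbours G u"
  shows "u \<in> \<Union>F \<or> v \<in> \<Union>F"
proof (rule ccontr)
  assume n: "\<not> ?thesis"
  have F: "matching_within G S F" "card F = matching_number_within G S"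
    using assms(1) by (auto simp: max_matching_within_def)
  have "{u, v} \<in> edges G" using assms(4) by (auto simp: edges_def neighbours_def)
  then have "matching_within G S (insert {u, v} F)"
    using F assms n by (intro matching_within_insert) auto
  then have "card (insert {u, v} F) \<le> card F" using card_matching_within_le F by metis
  moreover have "{u, v} \<notin> F" using n by auto
  ultimately show False using matching_within_finite[OF F(1)] by simp
qed

lemma matching_within_edge_at:
  assumes "matching_within G S F" "x \<in> \<Union>F"
  obtains y where "{x, y} \<in> F" "y \<in> neighbours G x" "y \<in> S" "x \<in> S"
proof -
  obtain e where e: "x \<in> e" "e \<in> F" using assms(2) by blast
  then have "e \<in> edges G" "e \<subseteq> S" using assms(1) by (auto simp: matching_within_def matching_def)
  then obtain a b where ab: "e = {a, b}" "(a, b) \<in> parcs G" by (auto simp: edges_def)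
  then have nb: "b \<in> neighbours G a" by (simp add: neighbours_def)
  have abS: "a \<in> S" "b \<in> S" using ab(1) \<open>e \<subseteq> S\<close> by auto
  show ?thesis
  proof (cases "x = a")
    case True
    then show ?thesis using that[of b] e(2) ab(1) nb abS by simp
  next
    case False
    then have "x = b" using e(1) ab(1) by simp
    then show ?thesis
      using that[of a] e(2) ab(1) neighbours_sym[OF nb] abS by (simp add: insert_commute)
  qed
qed

lemma matching_within_edge_unique:
  assumes "matching_within G S F" "e \<in> F" "f \<in> F" "e \<inter> f \<noteq> {}"
  shows "e = f"
  using assms by (auto simp: matching_within_def matching_def pairwise_def disjnt_def)

text \<open>This is the transitivity at the heart of Gallai's lemma: among all maximum matchings missing
  \<open>w\<close>, one having most edges in common with \<open>F\<close> could be exchanged to share yet another edge.\<close>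

lemma no_common_missed_trans:
  assumes uw: "\<And>N. max_matching_within G S N \<Longrightarrow> u \<in> \<Union>N \<or> w \<in> \<Union>N"
    and vw: "\<And>N. max_matching_within G S N \<Longrightarrow> v \<in> \<Union>N \<or> w \<in> \<Union>N"
    and w: "\<exists>N. max_matching_within G S N \<and> w \<notin> \<Union>N"
    and "u \<noteq> v" and F: "max_matching_within G S F"
  shows "u \<in> \<Union>F \<or> v \<in> \<Union>F"
proof (rule ccontr)
  assume miss: "\<not> ?thesis"
  let ?C = "{N. max_matching_within G S N \<and> w \<notin> \<Union>N}"
  have fC: "finite ?C"
    by (rule finite_subset[OF _ finite_matchings_within[of S]]) (auto simp: max_matching_within_def)
  moreover have "?C \<noteq> {}" using w by blast
  ultimately obtain N where N: "N \<in> ?C" "Max ((\<lambda>N. card (F \<inter> N)) ` ?C) = card (F \<inter> N)"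
    by (rule obtains_MAX)
  have Nmax: "card (F \<inter> N') \<le> card (F \<inter> N)" if "N' \<in> ?C" for N'
    using that fC unfolding N(2)[symmetric] by (intro Max_ge) auto
  have mF: "matching_within G S F" and mN: "matching_within G S N" and cN: "card F = card N"
    "card N = matching_number_within G S" and wN: "w \<notin> \<Union>N"
    using F N(1) by (auto simp: max_matching_within_def)
  have uvN: "u \<in> \<Union>N" "v \<in> \<Union>N" using uw vw N(1) wN by blast+
  note cF' = card_Union_matching_within[OF mF] and cN' = card_Union_matching_within[OF mN]
  \<comment> \<open>Both matchings cover equally many vertices, and \<open>N\<close> covers
    \<open>u\<close> and \<open>v\<close>, which \<open>F\<close> misses. So \<open>F\<close> covers
    two vertices missed by \<open>N\<close>, one of them other than \<open>w\<close>.\<close>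
  have "card (\<Union>N - \<Union>F) + card (\<Union>N \<inter> \<Union>F) = card (\<Union>F - \<Union>N) + card (\<Union>N \<inter> \<Union>F)"
    using cF' cN' cN by (metis Int_commute add.commute card_Int_Diff)
  moreover have "card {u, v} \<le> card (\<Union>N - \<Union>F)"
    using uvN miss cN' by (intro card_mono) auto
  ultimately have "2 \<le> card (\<Union>F - \<Union>N)" using \<open>u \<noteq> v\<close> by simp
  then have "\<not> \<Union>F - \<Union>N \<subseteq> {w}"
    using card_mono[of "{w}" "\<Union>F - \<Union>N"] by auto
  then obtain x where x: "x \<in> \<Union>F" "x \<notin> \<Union>N" "x \<noteq> w" by blast
  obtain y where y: "{x, y} \<in> F" "y \<in> neighbours G x" "y \<in> S" "x \<in> S"
    using matching_within_edge_at[OF mF x(1)] .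
  have yN: "y \<in> \<Union>N"
    using adjacent_not_both_missed[of S N x y] N(1) x y by auto
  obtain z where z: "{y, z} \<in> N" using matching_within_edge_at[OF mN yN] .
  \<comment> \<open>The exchange keeps the size, and \<open>w\<close> stays missed: it is neither
    \<open>x\<close> nor \<open>y\<close>, as \<open>y\<close> is covered by
    \<open>N\<close>.\<close>
  let ?N = "insert {x, y} (N - {{y, z}})"
  have yN': "y \<notin> \<Union>(N - {{y, z}})"
    using matching_within_edge_unique[OF mN _ z] by blast
  have "matching_within G S ?N"
  proof (rule matching_within_insert)
    show "matching_within G S (N - {{y, z}})" using mN by (rule matching_within_subset) auto
    show "{x, y} \<in> edges G" using y by (auto simp: edges_def neighbours_def)
  qed (use x y yN' in auto)
  moreover have "card ?N = card N"
    using x card_Suc_Diff1[OF matching_within_finite[OF mN] z] matching_within_finite[OF mN]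
    by (subst card_insert_disjoint) auto
  ultimately have "max_matching_within G S ?N" using cN by (simp add: max_matching_within_def)
  moreover have "w \<notin> \<Union>?N" using wN yN x by auto
  ultimately have le: "card (F \<inter> ?N) \<le> card (F \<inter> N)" using Nmax by blast
  \<comment> \<open>The edge of \<open>F\<close> at \<open>y\<close> is \<open>{x, y}\<close>, so
    the edge given up is not in \<open>F\<close>: the overlap gains one edge and loses none.\<close>
  have "{y, z} \<noteq> {x, y}" using x z by auto
  then have "{y, z} \<notin> F" using matching_within_edge_unique[OF mF _ y(1)] by blast
  then have "F \<inter> ?N = insert {x, y} (F \<inter> N)" using y by auto
  moreover have "{x, y} \<notin> F \<inter> N" using x by auto
  ultimately show False using le matching_within_finite[OF mF] by simp
qed

text \<open>Suppose some maximum matching misses both \<open>u\<close> and \<open>v\<close>.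
  Adjacent vertices are never missed together, and this relation is transitive, so it spreads from
  \<open>u\<close> over all of \<open>S\<close> and reaches \<open>v\<close>. Hence a maximum
  matching misses at most one vertex.\<close>

lemma gallai:
  assumes "finite S" and ind: "\<And>T. closed_in G S T \<Longrightarrow> T \<noteq> {} \<Longrightarrow> T = S"
    and miss: "\<And>v. v \<in> S \<Longrightarrow> \<exists>N. max_matching_within G S N \<and> v \<notin> \<Union>N"
  shows "card S \<le> 2 * matching_number_within G S + 1"
proof -
  obtain F where F: "max_matching_within G S F" using ex_max_matching_within by blast
  have "u = v" if uv: "u \<in> S - \<Union>F" "v \<in> S - \<Union>F" for u v
  proof (rule ccontr)
    assume "u \<noteq> v"
    define T where "T = {x \<in> S. x = u \<or> (\<forall>N. max_matching_within G S N \<longrightarrow> u \<in> \<Union>N \<or> x \<in> \<Union>N)}"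
    have "closed_in G S T" unfolding closed_in_def
    proof (intro conjI ballI subsetI)
      fix x y assume x: "x \<in> T" and y: "y \<in> neighbours G x \<inter> S"
      then have xS: "x \<in> S" by (simp add: T_def)
      have yx: "y \<in> \<Union>N \<or> x \<in> \<Union>N" if "max_matching_within G S N" for N
        using adjacent_not_both_missed[OF that xS, of y] y by blast
      show "y \<in> T"
      proof (cases "x = u \<or> y = u")
        case True
        then show ?thesis using yx y by (auto simp: T_def)
      next
        case False
        then have ux: "u \<in> \<Union>N \<or> x \<in> \<Union>N" if "max_matching_within G S N" for N
          using x that by (auto simp: T_def)
        have "u \<in> \<Union>N \<or> y \<in> \<Union>N" if "max_matching_within G S N" for N
          using no_common_missed_trans[OF ux yx miss[OF xS] _ that] False by blast
        then show ?thesis using y by (simp add: T_def)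
      qed
    qed (auto simp: T_def)
    moreover have "u \<in> T" using uv by (simp add: T_def)
    ultimately have "T = S" using ind by blast
    then have "v \<in> T" using uv by simp
    then show False using uv F \<open>u \<noteq> v\<close> by (auto simp: T_def)
  qed
  then have "card (S - \<Union>F) \<le> 1" using assms(1) by (auto simp: card_le_Suc0_iff_eq)
  moreover have "\<Union>F \<subseteq> S" "matching_within G S F" "card F = matching_number_within G S"
    using F by (auto simp: max_matching_within_def matching_within_def)
  ultimately show ?thesis
    using card_Union_matching_within[of S F] card_Diff_subset[of "\<Union>F" S] by simp
qed

section \<open>Seed sets by induction on the inactive part\<close>

text \<open>The root is chosen with an active neighbour if \<open>R\<close> is empty. The two seed
  sets then total at most \<open>2 * k + 1\<close>, or \<open>2 * k + 2\<close> if the root has no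
  active neighbour; in that case \<open>R\<close> is nonempty and pays for the extra seed.\<close>

lemma seeds_indecomposable:
  assumes S: "S \<subseteq> pverts G" "S \<noteq> {}" "S \<inter> X = {}" "\<And>v. v \<in> S \<Longrightarrow> neighbours G v \<subseteq> S \<union> X"
    and "R \<subseteq> S" "anchored G S X R"
    and ind: "\<And>T. closed_in G S T \<Longrightarrow> T \<noteq> {} \<Longrightarrow> T = S"
    and card: "card S \<le> 2 * k + 1"
  shows "\<exists>M \<subseteq> S. card M \<le> k + card R \<and> S \<subseteq> activated G (M \<union> X)"
proof -
  have fin: "finite S" using S(1) by (rule finite_subset) simp
  have "closed_in G S S" by (simp add: closed_in_def)
  then have "S \<inter> R \<noteq> {} \<or> (\<exists>v\<in>S. neighbours G v \<inter> X \<noteq> {})"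
    using assms(6) S(2) unfolding anchored_def by blast
  then obtain r where r: "r \<in> S" "R \<noteq> {} \<or> neighbours G r \<inter> X \<noteq> {}" by blast
  have "two_seeds G S {} {} X (card S + (if neighbours G r \<inter> X = {} then 1 else 0))"
    using S grown_if_indecomposable[OF fin r(1) ind] by (intro two_seeds_grown) auto
  then obtain M1 M2 where M: "M1 \<subseteq> S" "M2 \<subseteq> S" "S \<subseteq> activated G (M1 \<union> X)"
    "S \<subseteq> activated G (M2 \<union> X)"
    "card M1 + card M2 \<le> card S + (if neighbours G r \<inter> X = {} then 1 else 0)"
    unfolding two_seeds_def by auto
  have "R \<noteq> {} \<Longrightarrow> 1 \<le> card R" using finite_subset[OF assms(5) fin] by (simp add: Suc_le_eq card_gt_0_iff)
  then have "card M1 \<le> k + card R \<or> card M2 \<le> k + card R"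
    using M(5) card r(2) by (auto split: if_splits)
  then show ?thesis using M by blast
qed

lemma seeds_exist:
  assumes "S \<subseteq> pverts G" "S \<inter> X = {}" "\<And>v. v \<in> S \<Longrightarrow> neighbours G v \<subseteq> S \<union> X"
    "R \<subseteq> S" "anchored G S X R"
  shows "\<exists>M \<subseteq> S. card M \<le> matching_number_within G S + card R \<and> S \<subseteq> activated G (M \<union> X)"
  using assms
proof (induction "card S" arbitrary: S X R rule: less_induct)
  case less
  have fin: "finite S" using less.prems(1) by (rule finite_subset) simp
  have finR: "finite R" using less.prems(4) fin by (rule finite_subset)
  consider "S = {}"
    | T where "closed_in G S T" "T \<noteq> {}" "T \<noteq> S"
    | v where "v \<in> S" "\<And>N. max_matching_within G S N \<Longrightarrow> v \<in> \<Union>N"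
    | "S \<noteq> {}" "\<And>T. closed_in G S T \<Longrightarrow> T \<noteq> {} \<Longrightarrow> T = S"
      "\<And>v. v \<in> S \<Longrightarrow> \<exists>N. max_matching_within G S N \<and> v \<notin> \<Union>N"
    by metis
  then show ?case
  proof cases
    case 1
    then show ?thesis by auto
  next
    case (2 T)
    have T: "T \<subseteq> S" "\<And>v. v \<in> T \<Longrightarrow> neighbours G v \<inter> S \<subseteq> T"
      using 2 by (auto simp: closed_in_def)
    have nT: "neighbours G v \<inter> T = {}" if "v \<in> S - T" for v
      using T that neighbours_sym by blast
    have cl1: "closed_in G S U" if "closed_in G T U" for U
      using that T unfolding closed_in_def by blast
    \<comment> \<open>No edge joins \<open>T\<close> and \<open>S - T\<close>, so pieces closed in
      either part are closed in \<open>S\<close> and inherit their anchors.\<close>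
    have cl2: "closed_in G S U" if "closed_in G (S - T) U" for U
      using that nT unfolding closed_in_def by blast
    have "\<exists>M \<subseteq> T. card M \<le> matching_number_within G T + card (R \<inter> T) \<and>
        T \<subseteq> activated G (M \<union> X)"
    proof (rule less.hyps)
      show "card T < card S" using T 2 fin by (meson psubsetI psubset_card_mono)
      show "anchored G T X (R \<inter> T)" unfolding anchored_def
      proof (intro allI impI)
        fix U assume U: "closed_in G T U" "U \<noteq> {}"
        then have "U \<subseteq> T" by (simp add: closed_in_def)
        with cl1[OF U(1)] U less.prems(5)
        show "U \<inter> (R \<inter> T) \<noteq> {} \<or> (\<exists>v\<in>U. neighbours G v \<inter> X \<noteq> {})"
          unfolding anchored_def by blast
      qed
      show "neighbours G v \<subseteq> T \<union> X" if "v \<in> T" for v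
        using T that less.prems(3)[of v] by blast
    qed (use T less.prems in auto)
    then obtain M1 where M1: "M1 \<subseteq> T" "card M1 \<le> matching_number_within G T + card (R \<inter> T)"
      "T \<subseteq> activated G (M1 \<union> X)" by blast
    have "\<exists>M \<subseteq> S - T. card M \<le> matching_number_within G (S - T) + card (R - T) \<and>
        S - T \<subseteq> activated G (M \<union> X)"
    proof (rule less.hyps)
      show "card (S - T) < card S" using T 2 fin by (intro psubset_card_mono) auto
      show "anchored G (S - T) X (R - T)" unfolding anchored_def
      proof (intro allI impI)
        fix U assume U: "closed_in G (S - T) U" "U \<noteq> {}"
        then have "U \<subseteq> S - T" by (simp add: closed_in_def)
        with cl2[OF U(1)] U less.prems(5)
        show "U \<inter> (R - T) \<noteq> {} \<or> (\<exists>v\<in>U. neighbours G v \<inter> X \<noteq> {})"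
          unfolding anchored_def by blast
      qed
      show "neighbours G v \<subseteq> S - T \<union> X" if "v \<in> S - T" for v
        using nT[OF that] that less.prems(3)[of v] by blast
    qed (use T less.prems in auto)
    then obtain M2 where M2: "M2 \<subseteq> S - T"
      "card M2 \<le> matching_number_within G (S - T) + card (R - T)"
      "S - T \<subseteq> activated G (M2 \<union> X)" by blast
    have "activated G (M1 \<union> X) \<subseteq> activated G (M1 \<union> M2 \<union> X)"
      "activated G (M2 \<union> X) \<subseteq> activated G (M1 \<union> M2 \<union> X)"
      by (auto intro!: activated_mono)
    then have "S \<subseteq> activated G (M1 \<union> M2 \<union> X)" using M1(3) M2(3) by blast
    moreover have "card (M1 \<union> M2) \<le> matching_number_within G S + card R"
      using card_Un_le[of M1 M2] M1(2) M2(2) matching_number_within_split[OF T(1)]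
        card_Int_Diff[OF finR, of T] by linarith
    moreover have "M1 \<union> M2 \<subseteq> S" using M1 M2 T by blast
    ultimately show ?thesis by blast
  next
    case (3 v)
    \<comment> \<open>A matching avoiding \<open>v\<close> is not maximum in \<open>S\<close>; this
      drop pays for the seed \<open>v\<close>.\<close>
    have "matching_number_within G (S - {v}) < matching_number_within G S"
    proof -
      obtain N where N: "max_matching_within G (S - {v}) N" using ex_max_matching_within by blast
      then have "matching_within G S N" "v \<notin> \<Union>N"
        by (auto simp: max_matching_within_def matching_within_def)
      then have "card N < matching_number_within G S"
        using 3(2)[of N] card_matching_within_le[of S N]
        by (auto simp: max_matching_within_def order_le_less)
      then show ?thesis using N by (simp add: max_matching_within_def)
    qed
    moreover have "\<exists>M \<subseteq> S - {v}. card M \<le> matching_number_within G (S - {v}) + card (R - {v}) \<and>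
        S - {v} \<subseteq> activated G (M \<union> insert v X)"
    proof (rule less.hyps)
      show "card (S - {v}) < card S" using 3 fin by (intro psubset_card_mono) auto
      show "anchored G (S - {v}) (insert v X) (R - {v})" unfolding anchored_def
      proof (intro allI impI)
        fix U assume U: "closed_in G (S - {v}) U" "U \<noteq> {}"
        show "U \<inter> (R - {v}) \<noteq> {} \<or> (\<exists>w\<in>U. neighbours G w \<inter> insert v X \<noteq> {})"
        \<comment> \<open>A piece adjacent to \<open>v\<close> is anchored by the now active
          \<open>v\<close>; any other piece was already closed in \<open>S\<close>.\<close>
        proof (cases "\<exists>w\<in>U. v \<in> neighbours G w")
          case False
          then have "closed_in G S U" "v \<notin> U" using U(1) unfolding closed_in_def by blast+
          then show ?thesis using U(2) less.prems(5) unfolding anchored_def by blast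
        qed blast
      qed
      show "neighbours G w \<subseteq> S - {v} \<union> insert v X" if "w \<in> S - {v}" for w
        using that less.prems(3)[of w] by blast
    qed (use 3 less.prems in auto)
    then obtain M where M: "M \<subseteq> S - {v}"
      "card M \<le> matching_number_within G (S - {v}) + card (R - {v})"
      "S - {v} \<subseteq> activated G (M \<union> insert v X)" by blast
    have "card (R - {v}) \<le> card R" using finR by (intro card_mono) auto
    moreover have "card (insert v M) \<le> Suc (card M)" by (rule card_insert_le_m1) simp_all
    moreover have "S \<subseteq> activated G (insert v M \<union> X)"
      using M(3) by (auto intro: activated.seed)
    moreover have "insert v M \<subseteq> S" using M 3 by blast
    ultimately show ?thesis using M(2)
      by (intro exI[of _ "insert v M"]) linarith
  next
    case 4
    show ?thesis
      using less.prems 4 gallai[OF fin 4(2,3)] by (intro seeds_indecomposable) auto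
  qed
qed

section \<open>Components of the whole graph\<close>

lemma matching_number_within_verts: "matching_number_within G (pverts G) = matching_number G"
proof -
  have "matching_within G (pverts G) F = matching G F" for F
    using edges_subset by (auto simp: matching_within_def matching_def)
  then show ?thesis by (simp add: matching_number_within_def matching_number_def)
qed

lemma dynamo_le_matching_number_components:
  "\<exists>M. strict_majority_dynamo G M \<and> card M \<le> matching_number G + card (components G)"
proof -
  define R where "R = (\<lambda>H. SOME v. v \<in> verts H) ` components G"
  \<comment> \<open>The view as strongly connected components supplies finiteness and nonemptiness,
    and shows that the vertices reachable from a given one induce a component.\<close>
  have comp: "components G = sccs" by (rule components_eq_sccs) unfold_locales
  have fin: "finite (components G)"
    unfolding comp using finite_sccs_verts sccs_conv_sccs_verts by simp
  have rep: "(SOME v. v \<in> verts H) \<in> verts H" if "H \<in> components G" for H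
  proof -
    have "verts H \<noteq> {}" using that unfolding comp by (auto simp: strongly_connected_def)
    then show ?thesis by (auto intro: someI)
  qed
  have subs: "verts H \<subseteq> pverts G" if "H \<in> components G" for H
    using that unfolding components_def max_subgraph_def by (auto simp: subgraph_def)
  have RV: "R \<subseteq> pverts G" using rep subs unfolding R_def by blast
  have "anchored G (pverts G) {} R" unfolding anchored_def
  proof (intro allI impI disjI1)
    fix T assume T: "closed_in G (pverts G) T" "T \<noteq> {}"
    then obtain x where x: "x \<in> T" "x \<in> pverts G" by (auto simp: closed_in_def)
    \<comment> \<open>A closed set containing \<open>x\<close> contains everything reachable from
      \<open>x\<close>, hence the representative of the component of \<open>x\<close>.\<close>
    let ?H = "with_proj G \<restriction> {y. x \<rightarrow>\<^sup>*\<^bsub>with_proj G\<^esub> y}"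
    have H: "?H \<in> components G" unfolding comp using x induce_reachable_is_in_sccs by simp
    have "y \<in> T" if "x \<rightarrow>\<^sup>*\<^bsub>with_proj G\<^esub> y" for y
      using that
    proof (induction rule: reachable_induct)
      case base
      then show ?case using x by simp
    next
      case (step y z)
      then have "z \<in> neighbours G y \<inter> pverts G"
        using neighbours_subset by (auto simp: neighbours_def)
      then show ?case using step T by (auto simp: closed_in_def)
    qed
    then have "(SOME v. v \<in> verts ?H) \<in> T" using rep[OF H] by simp
    then show "T \<inter> R \<noteq> {}" using H unfolding R_def by blast
  qed
  then obtain M where M: "M \<subseteq> pverts G" "card M \<le> matching_number G + card R"
    "pverts G \<subseteq> activated G M"
    using seeds_exist[of "pverts G" "{}" R] RV neighbours_subset
    by (auto simp: matching_number_within_verts)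
  have "card R \<le> card (components G)" unfolding R_def using fin by (rule card_image_le)
  then show ?thesis using dynamo_if_activated[OF M(1,3)] M(2) by (meson add_left_mono order_trans)
qed

text \<open>Every component is a subgraph of the connected \<open>with_proj G\<close>, so maximality
  makes the two equal.\<close>

lemma components_connected:
  assumes "connected (with_proj G)" shows "components G \<subseteq> {with_proj G}"
proof
  fix H assume "H \<in> components G"
  then have "max_subgraph connected H" by (simp add: components_def)
  then show "H \<in> {with_proj G}"
    using assms subgraph_refl unfolding max_subgraph_def by (metis singletonI)
qed

end

theorem theorem4:
  fixes G :: "'a pair_pre_digraph"
  assumes "pair_graph G"
  shows "(connected (with_proj G) \<longrightarrow>
            (\<exists>M. strict_majority_dynamo G M \<and> card M \<le> matching_number G + 1)) \<and>
         (\<exists>M. strict_majority_dynamo G M \<and>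
            card M \<le> matching_number G + card (components G))"
proof -
  interpret pair_graph G by fact
  have "card (components G) \<le> 1" if "connected (with_proj G)"
    using card_mono[OF _ components_connected[OF that]] by simp
  then show ?thesis using dynamo_le_matching_number_components
    by (meson add_left_mono order_trans)
qed

end
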